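(* Let $F$ be a number field with ring of integers $\mathcal{O}_F$ and class number $h_F$. Suppose $5$ is totally ramified in $F$ and that $h_F$ and $[F:\mathbb{Q}]$ are both odd. Then the unit equation $\lambda + \mu = 1$ has no solutions with $\lambda, \mu \in \mathcal{O}_F^\times$.
   Context: A rational prime $p$ is totally ramified in a number field $F$ if $p\mathcal{O}_F = \mathfrak{p}^{[F:\mathbb{Q}]}$ for a prime ideal $\mathfrak{p}$ of $\mathcal{O}_F$. $\mathcal{O}_F^\times$ denotes the unit group of $\mathcal{O}_F$. *)

theory Defs
  imports
    "HOL-Computational_Algebra.Computational_Algebra"
    "HOL-Algebra.Coset"
    "HOL-Algebra.Ideal_Product"
    "HOL-Algebra.Subrings"
    "HOL-Algebra.Algebraic_Closure_Type"
begin

global_interpretation rat_vs: vector_space "\<lambda>(q :: rat) (x :: 'a :: field_char_0). of_rat q * x"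
  by unfold_locales (simp_all add: algebra_simps of_rat_add of_rat_mult)

text \<open>
  A number field is a subfield of some ambient field of characteristic 0 (possibly the whole type)
  that is spanned over the rationals by finitely many elements.
\<close>

definition number_field :: "'a :: field_char_0 set \<Rightarrow> bool" where
  "number_field F \<longleftrightarrow>
     subfield F ring_of_type_algebra \<and> (\<exists>B. finite B \<and> B \<subseteq> F \<and> F \<subseteq> rat_vs.span B)"

definition field_degree :: "'a :: field_char_0 set \<Rightarrow> nat" where
  "field_degree F = rat_vs.dim F"

definition ring_of_integers :: "'a :: field_char_0 set \<Rightarrow> 'a ring" where
  "ring_of_integers F = ring_of_type_algebra \<lparr> carrier := {x \<in> F. algebraic_int x} \<rparr>"

text \<open>
  Fractional ideals are the nonzero \<open>\<O>\<^sub>F\<close>-submodules of \<open>F\<close> with a common denominator. Their product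
  is the additive closure of the set of elementwise products, which is what \<^const>\<open>ideal_prod\<close>
  yields in the ambient ring also for sets that are not ideals.
\<close>

definition fractional_ideal :: "'a :: field_char_0 set \<Rightarrow> 'a set \<Rightarrow> bool" where
  "fractional_ideal F I \<longleftrightarrow>
     I \<subseteq> F \<and> 0 \<in> I \<and> I \<noteq> {0} \<and>
     (\<forall>x\<in>I. \<forall>y\<in>I. x + y \<in> I) \<and>
     (\<forall>a\<in>carrier (ring_of_integers F). \<forall>x\<in>I. a * x \<in> I) \<and>
     (\<exists>d\<in>carrier (ring_of_integers F). d \<noteq> 0 \<and> (\<forall>x\<in>I. d * x \<in> carrier (ring_of_integers F)))"

definition fractional_ideal_group :: "'a :: field_char_0 set \<Rightarrow> 'a set monoid" where
  "fractional_ideal_group F =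
     \<lparr> carrier = {I. fractional_ideal F I},
       monoid.mult = ideal_prod ring_of_type_algebra,
       one = carrier (ring_of_integers F) \<rparr>"

definition principal_fractional_ideals :: "'a :: field_char_0 set \<Rightarrow> 'a set set" where
  "principal_fractional_ideals F =
     {(\<lambda>x. a * x) ` carrier (ring_of_integers F) | a. a \<in> F \<and> a \<noteq> 0}"

definition class_group :: "'a :: field_char_0 set \<Rightarrow> 'a set set monoid" where
  "class_group F = fractional_ideal_group F Mod principal_fractional_ideals F"

definition class_number :: "'a :: field_char_0 set \<Rightarrow> nat" where
  "class_number F = Coset.order (class_group F)"

definition totally_ramified :: "nat \<Rightarrow> 'a :: field_char_0 set \<Rightarrow> bool" where
  "totally_ramified p F \<longleftrightarrow>
     prime p \<and>
     (\<exists>P. primeideal P (ring_of_integers F) \<and>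
          PIdl\<^bsub>ring_of_integers F\<^esub> (of_nat p) = P [^]\<^bsub>ideals_set (ring_of_integers F)\<^esub> field_degree F)"

end

theory Submission imports Defs
begin

text \<open>
  Since \<open>n = [F : \<rat>]\<close> and \<open>p \<O>\<^sub>F = P\<^sup>n\<close>, every integer \<open>u\<close> of \<open>F\<close> is congruent to a rational integer \<open>a\<close>
  modulo \<open>P\<close>. Then \<open>w = u - a\<close> satisfies \<open>w\<^sup>n \<in> p \<O>\<^sub>F\<close>, so a power of \<open>X\<close> is, modulo \<open>p\<close>, divisible by the
  minimal polynomial \<open>Q\<close> of \<open>w\<close>; hence \<open>Q \<equiv> X\<^sup>m\<close> modulo \<open>p\<close>, where \<open>m = deg Q\<close> divides \<open>n\<close>. If \<open>u\<close> is a
  unit, then \<open>Q (-a) = \<plusminus>1\<close>, that is, \<open>a\<^sup>m \<equiv> \<plusminus>1\<close> modulo \<open>p\<close>. For \<open>p = 5\<close> and \<open>n\<close> odd this forces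
  \<open>a \<equiv> \<plusminus>1\<close> modulo \<open>5\<close>, and no two such residues add up to \<open>1\<close>.
\<close>

subsection \<open>Integer polynomials vanishing at an algebraic integer\<close>

text \<open>Coefficients stay integral, instead of passing to minimal polynomials over the
  rationals, so that divisibility of coefficients by a prime can be expressed directly.\<close>

definition int_poly_eval :: "int poly \<Rightarrow> 'a :: field_char_0 \<Rightarrow> 'a" where
  "int_poly_eval p x = poly (map_poly of_int p) x"

lemma int_poly_eval_0 [simp]: "int_poly_eval 0 x = 0"
  by (simp add: int_poly_eval_def)

lemma int_poly_eval_pCons [simp]:
  "int_poly_eval (pCons a p) x = of_int a + x * int_poly_eval p x"
  by (simp add: int_poly_eval_def map_poly_pCons)

lemma int_poly_eval_1 [simp]: "int_poly_eval 1 x = 1"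
  by (simp add: one_pCons)

lemma int_poly_eval_add [simp]:
  "int_poly_eval (p + q) x = int_poly_eval p x + int_poly_eval q x"
  by (induction p q rule: poly_induct2) (simp_all add: algebra_simps)

lemma int_poly_eval_smult [simp]: "int_poly_eval (smult c p) x = of_int c * int_poly_eval p x"
  by (induction p) (simp_all add: algebra_simps)

lemma int_poly_eval_mult [simp]:
  "int_poly_eval (p * q) x = int_poly_eval p x * int_poly_eval q x"
  by (induction p) (simp_all add: algebra_simps)

lemma int_poly_eval_monom [simp]: "int_poly_eval (Polynomial.monom c n) x = of_int c * x ^ n"
  by (simp add: int_poly_eval_def map_poly_monom poly_monom)

lemma int_poly_eval_sum [simp]:
  "int_poly_eval (sum f A) x = (\<Sum>i\<in>A. int_poly_eval (f i) x)"
  by (induction A rule: infinite_finite_induct) simp_all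

lemma int_poly_eval_pcompose: "int_poly_eval (pcompose p q) x = int_poly_eval p (int_poly_eval q x)"
  by (induction p) (simp_all add: pcompose_pCons)

lemma int_poly_eval_altdef:
  "int_poly_eval p x = (\<Sum>i\<le>Polynomial.degree p. of_int (Polynomial.coeff p i) * x ^ i)"
  by (simp add: int_poly_eval_def poly_altdef coeff_map_poly degree_map_poly)

lemma int_poly_eval_reflect_poly:
  assumes "x \<noteq> 0"
  shows "int_poly_eval (reflect_poly p) x = x ^ Polynomial.degree p * int_poly_eval p (inverse x)"
proof -
  have "map_poly of_int (reflect_poly p) = reflect_poly (map_poly of_int p :: 'a poly)"
    by (rule poly_eqI) (simp add: coeff_reflect_poly coeff_map_poly degree_map_poly)
  then show ?thesis
    using assms by (simp add: int_poly_eval_def poly_reflect_poly_nz degree_map_poly)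
qed

lemma algebraic_intE_int_poly:
  assumes "algebraic_int x"
  obtains p where "int_poly_eval p x = 0" "Polynomial.lead_coeff p = 1"
  using assms unfolding algebraic_int_altdef_ipoly int_poly_eval_def by blast

text \<open>Saturation stands in for working over the field of rationals: a primitive element of
  least degree divides every member up to an integer factor by pseudo-division, and Gauss's lemma on
  contents removes that factor.\<close>

lemma saturated_ideal_int_poly_principal:
  fixes I :: "int poly set"
  assumes add: "\<And>p q. p \<in> I \<Longrightarrow> q \<in> I \<Longrightarrow> p + q \<in> I"
    and mult: "\<And>p q. p \<in> I \<Longrightarrow> q * p \<in> I"
    and saturated: "\<And>c p. c \<noteq> 0 \<Longrightarrow> smult c p \<in> I \<Longrightarrow> p \<in> I"
    and P: "P \<in> I" "P \<noteq> 0"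
  obtains Q where "content Q = 1" "I = {p. Q dvd p}"
proof -
  obtain Q0 where Q0: "Q0 \<in> I" "Q0 \<noteq> 0"
    and least: "\<And>q. q \<in> I \<Longrightarrow> q \<noteq> 0 \<Longrightarrow> Polynomial.degree Q0 \<le> Polynomial.degree q"
    using ex_has_least_nat[of "\<lambda>q. q \<in> I \<and> q \<noteq> 0" P Polynomial.degree] P by blast
  define Q where "Q = primitive_part Q0"
  have Q: "content Q = 1" "Q \<in> I" "Q \<noteq> 0"
    using Q0 saturated[of "content Q0" Q] by (simp_all add: Q_def)
  have deg: "Polynomial.degree Q = Polynomial.degree Q0"
    by (simp add: Q_def)
  have "Q dvd f" if f: "f \<in> I" for f
  proof -
    obtain g r where gr: "pseudo_divmod f Q = (g, r)" by (cases "pseudo_divmod f Q")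
    define c where "c = Polynomial.lead_coeff Q ^ (Suc (Polynomial.degree f) - Polynomial.degree Q)"
    have eq: "smult c f = Q * g + r" and r: "r = 0 \<or> Polynomial.degree r < Polynomial.degree Q"
      using pseudo_divmod[OF \<open>Q \<noteq> 0\<close> gr] by (simp_all add: c_def)
    have "c \<noteq> 0" using \<open>Q \<noteq> 0\<close> by (simp add: c_def)
    have "r = [:c:] * f + (- g) * Q" using eq by (simp add: algebra_simps)
    then have "r \<in> I" using add mult f Q by metis
    then have "r = 0" using r least[of r] deg by force
    then have *: "smult c f = Q * g" using eq by simp
    \<comment> \<open>Since \<open>Q\<close> is primitive, the factor \<open>c\<close> left by
      pseudo-division divides the content of \<open>g\<close>, hence can be cancelled on both
      sides.\<close>
    have "content g = normalize c * content f"
      using arg_cong[OF *, of content] Q(1) by (simp only: content_mult content_smult mult_1)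
    then have "[:c:] dvd g" by (simp add: const_poly_dvd_iff_dvd_content)
    then obtain g' where "g = smult c g'" by (auto elim!: dvdE)
    then have "smult c f = smult c (Q * g')" using * by simp
    then have "f = Q * g'" using \<open>c \<noteq> 0\<close> by (simp add: smult_cancel)
    then show ?thesis by simp
  qed
  moreover have "f \<in> I" if "Q dvd f" for f
    using that Q mult by (metis dvdE mult.commute)
  ultimately have "I = {p. Q dvd p}" by blast
  with Q show ?thesis using that by blast
qed

text \<open>The generator \<open>Q\<close> is the minimal polynomial up to sign: it divides a monic
  integer polynomial, so its leading coefficient is a unit.\<close>

lemma int_poly_vanishing_ideal:
  fixes x :: "'a :: field_char_0"
  assumes "algebraic_int x"
  obtains Q where "\<And>p. int_poly_eval p x = 0 \<longleftrightarrow> Q dvd p" "\<bar>Polynomial.lead_coeff Q\<bar> = 1"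
proof -
  obtain h where h: "int_poly_eval h x = 0" "Polynomial.lead_coeff h = 1"
    using assms by (rule algebraic_intE_int_poly)
  obtain Q where Q: "{p. int_poly_eval p x = 0} = {p. Q dvd p}"
    using h by (rule_tac saturated_ideal_int_poly_principal[of "{p. int_poly_eval p x = 0}" h]) auto
  then have iff: "int_poly_eval p x = 0 \<longleftrightarrow> Q dvd p" for p by blast
  then obtain k where "h = Q * k" using h by (auto elim: dvdE)
  then have "Polynomial.lead_coeff Q * Polynomial.lead_coeff k = 1"
    using h by (simp add: lead_coeff_mult)
  then have "\<bar>Polynomial.lead_coeff Q\<bar> = 1"
    by (metis dvd_triv_left zdvd1_eq)
  with iff show ?thesis using that by blast
qed

section \<open>Minimal polynomials that reduce to a power of X modulo a prime\<close>

text \<open>Over the field with \<open>p\<close> elements, a factor of a monomial is a monomial. As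
  in Eisenstein's argument, the lowest coefficients of \<open>Q\<close> and \<open>S\<close> not
  divisible by \<open>p\<close> multiply to one of \<open>Q * S\<close> not divisible by
  \<open>p\<close>.\<close>

lemma prime_dvd_coeff_factor:
  fixes p :: int
  assumes "prime p"
    and low: "\<And>k. k < Polynomial.degree (Q * S) \<Longrightarrow> p dvd Polynomial.coeff (Q * S) k"
    and lead: "\<not> p dvd Polynomial.lead_coeff (Q * S)"
    and i: "i < Polynomial.degree Q"
  shows "p dvd Polynomial.coeff Q i"
proof (rule ccontr)
  assume i': "\<not> p dvd Polynomial.coeff Q i"
  define k where "k = (LEAST k. \<not> p dvd Polynomial.coeff Q k)"
  define l where "l = (LEAST l. \<not> p dvd Polynomial.coeff S l)"
  have nz: "Q \<noteq> 0" "S \<noteq> 0" using lead by auto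
  have "\<not> p dvd Polynomial.lead_coeff S" using lead by (auto simp: lead_coeff_mult)
  then have l: "\<not> p dvd Polynomial.coeff S l" "l \<le> Polynomial.degree S"
    unfolding l_def by (rule LeastI, rule Least_le)
  have k: "\<not> p dvd Polynomial.coeff Q k" "k \<le> i"
    unfolding k_def using i' by (rule LeastI, intro Least_le)
  have ks: "p dvd Polynomial.coeff Q j" if "j < k" for j
    using that not_less_Least unfolding k_def by blast
  have ls: "p dvd Polynomial.coeff S j" if "j < l" for j
    using that not_less_Least unfolding l_def by blast
  have "Polynomial.coeff (Q * S) (k + l) =
      (\<Sum>j\<le>k + l. Polynomial.coeff Q j * Polynomial.coeff S (k + l - j))"
    by (rule coeff_mult)
  also have "\<dots> = Polynomial.coeff Q k * Polynomial.coeff S l +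
      (\<Sum>j\<in>{..k + l} - {k}. Polynomial.coeff Q j * Polynomial.coeff S (k + l - j))"
    by (subst sum.remove[of _ k]) auto
  finally have eq: "Polynomial.coeff (Q * S) (k + l) = \<dots>" .
  have "p dvd (\<Sum>j\<in>{..k + l} - {k}. Polynomial.coeff Q j * Polynomial.coeff S (k + l - j))"
  proof (rule dvd_sum)
    fix j assume "j \<in> {..k + l} - {k}"
    then have "j < k \<or> k + l - j < l" by auto
    then show "p dvd Polynomial.coeff Q j * Polynomial.coeff S (k + l - j)"
      using ks ls by auto
  qed
  \<comment> \<open>Here \<open>k < degree Q\<close> and \<open>l <= degree S\<close>, so
    \<open>k + l\<close> is strictly below the degree of the product.\<close>
  moreover have "p dvd Polynomial.coeff (Q * S) (k + l)"
    using low[of "k + l"] k l i nz by (simp add: degree_mult_eq)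
  ultimately have "p dvd Polynomial.coeff Q k * Polynomial.coeff S l"
    using eq by (simp add: dvd_add_left_iff)
  then show False using k l prime_dvd_mult_iff[OF \<open>prime p\<close>] by blast
qed

text \<open>From a monic equation for \<open>z\<close> one obtains a monic equation for
  \<open>w\<close> whose lower coefficients are all divisible by \<open>p\<close>; \<open>Q\<close>
  divides it and inherits that property.\<close>

lemma vanishing_int_poly_mod_prime:
  fixes w z :: "'a :: field_char_0" and p :: int
  assumes "prime p" "n > 0" and z: "algebraic_int z" and wz: "w ^ n = of_int p * z"
  obtains Q where "\<And>f. int_poly_eval f w = 0 \<longleftrightarrow> Q dvd f" "\<bar>Polynomial.lead_coeff Q\<bar> = 1"
    "\<And>i. i < Polynomial.degree Q \<Longrightarrow> p dvd Polynomial.coeff Q i"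
proof -
  obtain h where h: "int_poly_eval h z = 0" "Polynomial.lead_coeff h = 1"
    using z by (rule algebraic_intE_int_poly)
  define d where "d = Polynomial.degree h"
  \<comment> \<open>This is \<open>p^d * h(X^n / p)\<close>, with the denominators cleared.\<close>
  define H where "H = (\<Sum>i\<le>d. Polynomial.monom (Polynomial.coeff h i * p ^ (d - i)) (n * i))"
  have "int_poly_eval H w = (\<Sum>i\<le>d. of_int (Polynomial.coeff h i * p ^ (d - i)) * (w ^ n) ^ i)"
    by (simp add: H_def power_mult)
  also have "\<dots> = (\<Sum>i\<le>d. of_int p ^ d * (of_int (Polynomial.coeff h i) * z ^ i))"
    by (intro sum.cong) (auto simp: wz power_mult_distrib simp flip: power_add)
  also have "\<dots> = of_int p ^ d * int_poly_eval h z"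
    by (simp add: int_poly_eval_altdef d_def sum_distrib_left)
  finally have H0: "int_poly_eval H w = 0" using h by simp
  have coeff_H: "Polynomial.coeff H k =
      (\<Sum>i\<le>d. if n * i = k then Polynomial.coeff h i * p ^ (d - i) else 0)" for k
    by (simp add: H_def coeff_sum)
  have top: "Polynomial.coeff H (n * d) = 1"
  proof -
    have "Polynomial.coeff H (n * d) = (\<Sum>i\<le>d. if i = d then 1 else 0)"
      unfolding coeff_H using h \<open>n > 0\<close> by (intro sum.cong) (auto simp: d_def)
    then show ?thesis by simp
  qed
  have "Polynomial.degree H \<le> n * d"
    unfolding H_def by (intro degree_sum_le) (auto intro: order.trans[OF degree_monom_le])
  then have deg: "Polynomial.degree H = n * d"
    using top by (intro antisym le_degree) auto
  have low: "p dvd Polynomial.coeff H k" if "k < n * d" for k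
    unfolding coeff_H
  proof (rule dvd_sum)
    fix i assume "i \<in> {..d}"
    then show "p dvd (if n * i = k then Polynomial.coeff h i * p ^ (d - i) else 0)"
      using that by (cases "i = d") (auto intro!: dvd_mult dvd_power)
  qed
  have Hlead: "Polynomial.lead_coeff H = 1" using top deg by simp
  have "algebraic_int w"
    unfolding algebraic_int_altdef_ipoly using H0 Hlead by (auto simp: int_poly_eval_def)
  then obtain Q where Q: "\<And>f. int_poly_eval f w = 0 \<longleftrightarrow> Q dvd f" "\<bar>Polynomial.lead_coeff Q\<bar> = 1"
    using int_poly_vanishing_ideal[of w] by blast
  obtain S where S: "H = Q * S" using Q H0 by (auto elim: dvdE)
  have "p dvd Polynomial.coeff Q i" if "i < Polynomial.degree Q" for i
    using prime_dvd_coeff_factor[of p Q S i] low that deg Hlead \<open>prime p\<close>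
    by (auto simp: S)
  with Q show ?thesis using that by blast
qed

text \<open>Up to sign, \<open>Q(-a)\<close> is the norm of the unit \<open>w + a\<close> from the
  field generated by \<open>w\<close>, so it should be 1 or -1; modulo \<open>p\<close> only the
  leading term of \<open>Q\<close> contributes to it.\<close>

lemma unit_residue_power_mod_prime:
  fixes w z v :: "'a :: field_char_0" and p a :: int
  assumes "prime p" "n > 0" "algebraic_int z" "w ^ n = of_int p * z"
    and v: "algebraic_int v" "(w + of_int a) * v = 1"
  obtains Q where "\<And>f. int_poly_eval f w = 0 \<longleftrightarrow> Q dvd f" "\<bar>Polynomial.lead_coeff Q\<bar> = 1"
    "p dvd a ^ Polynomial.degree Q - 1 \<or> p dvd a ^ Polynomial.degree Q + 1"
proof -
  obtain Q where Q: "\<And>f. int_poly_eval f w = 0 \<longleftrightarrow> Q dvd f" "\<bar>Polynomial.lead_coeff Q\<bar> = 1"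
    "\<And>i. i < Polynomial.degree Q \<Longrightarrow> p dvd Polynomial.coeff Q i"
    using vanishing_int_poly_mod_prime[OF assms(1-4)] by blast
  obtain k where k: "int_poly_eval k v = 0" "Polynomial.lead_coeff k = 1"
    using v(1) by (rule algebraic_intE_int_poly)
  have "w + of_int a \<noteq> 0" "inverse (w + of_int a) = v"
    using v(2) inverse_unique by auto
  \<comment> \<open>Reversing the monic equation of \<open>v = 1 / (w + a)\<close> gives a
    polynomial that vanishes at \<open>w + a\<close> and has constant term 1. After the shift by
    \<open>a\<close> it is a multiple of \<open>Q\<close> with value 1 at \<open>-a\<close>, so
    \<open>Q(-a)\<close> divides 1 without any use of norms.\<close>
  then have "int_poly_eval (pcompose (reflect_poly k) [:a, 1:]) w = 0"
    using k by (simp add: int_poly_eval_pcompose int_poly_eval_reflect_poly add.commute)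
  then have "poly Q (- a) dvd poly (pcompose (reflect_poly k) [:a, 1:]) (- a)"
    using Q(1) by (metis dvdE poly_mult dvd_triv_left)
  also have "\<dots> = 1" using k by (simp add: poly_pcompose poly_0_coeff_0)
  finally have unit: "\<bar>poly Q (- a)\<bar> = 1" by simp
  define m where "m = Polynomial.degree Q"
  have "poly Q (- a) = (\<Sum>i\<le>m. Polynomial.coeff Q i * (- a) ^ i)"
    by (simp add: poly_altdef m_def)
  also have "\<dots> = (\<Sum>i<m. Polynomial.coeff Q i * (- a) ^ i) + Polynomial.lead_coeff Q * (- a) ^ m"
    by (simp add: m_def flip: lessThan_Suc_atMost)
  finally have eq: "poly Q (- a) = \<dots>" .
  have "p dvd (\<Sum>i<m. Polynomial.coeff Q i * (- a) ^ i)"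
    by (intro dvd_sum dvd_mult2) (simp add: Q(3) m_def)
  then have "p dvd poly Q (- a) - Polynomial.lead_coeff Q * (- a) ^ m"
    using eq by simp
  \<comment> \<open>The signs of the leading coefficient and of \<open>(-1)^m\<close> are merged
    into one alternative.\<close>
  then have "p dvd poly Q (-a) - a ^ m \<or> p dvd poly Q (-a) + a ^ m"
    using Q(2) by (cases "even m") (auto simp: abs_if split: if_splits)
  then have "p dvd a ^ m - 1 \<or> p dvd a ^ m + 1"
    using unit by (auto simp: abs_if dvd_diff_commute add.commute minus_diff_commute split: if_splits)
  with Q show ?thesis using that unfolding m_def by blast
qed

subsection \<open>Dimensions over the rationals\<close>

lemma common_denominator:
  fixes u :: "'b \<Rightarrow> rat"
  assumes "finite A"
  obtains d :: int and k where "d > 0" "\<And>x. x \<in> A \<Longrightarrow> of_int d * u x = of_int (k x)"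
proof -
  define den where "den x = snd (quotient_of (u x))" for x
  define k where "k x = fst (quotient_of (u x)) * prod den (A - {x})" for x
  have den: "den x > 0" "u x = of_int (fst (quotient_of (u x))) / of_int (den x)" for x
    using quotient_of_denom_pos' quotient_of_div[of "u x"] by (auto simp: den_def)
  have "of_int (prod den A) * u x = of_int (k x)" if "x \<in> A" for x
    using den(1)[of x] that
    by (subst den(2)) (simp add: k_def prod.remove[OF assms that] del: of_int_prod)
  moreover have "prod den A > 0" using den by (simp add: prod_pos)
  ultimately show ?thesis using that by blast
qed

text \<open>Infinite descent: a relation divided by \<open>p\<close> is again a relation, so every
  power of \<open>p\<close> divides each coefficient.\<close>

lemma all_zero_of_relations_divisible:
  fixes e :: "nat \<Rightarrow> 'a :: field_char_0" and p :: int
  assumes p: "prime p"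
    and div: "\<And>c i. (\<Sum>i<N. of_int (c i) * e i) = 0 \<Longrightarrow> i < N \<Longrightarrow> p dvd c i"
    and rel: "(\<Sum>i<N. of_int (c i) * e i) = 0" and i: "i < N"
  shows "c i = 0"
proof (rule ccontr)
  assume nz: "c i \<noteq> 0"
  have pow: "p ^ k dvd c i" if "(\<Sum>i<N. of_int (c i) * e i) = 0" for k c
    using that
  proof (induction k arbitrary: c)
    case (Suc k)
    define c' where "c' j = c j div p" for j
    have c: "c j = p * c' j" if "j < N" for j
      using div[OF Suc.prems that] by (simp add: c'_def)
    have "0 = (\<Sum>j<N. of_int p * (of_int (c' j) * e j))"
      using Suc.prems c by (simp add: mult.assoc)
    then have "(\<Sum>j<N. of_int (c' j) * e j) = 0"
      using p by (simp flip: sum_distrib_left)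
    then show ?case using Suc.IH c[OF i] by simp
  qed simp
  have "p > 1" using p by (simp add: prime_gt_1_int)
  \<comment> \<open>This exponent is large enough, because \<open>k < 2^k <= p^k\<close>.\<close>
  define k where "k = nat \<bar>c i\<bar>"
  have "p ^ k \<le> \<bar>c i\<bar>" using dvd_imp_le_int[OF nz pow[OF rel, of k]] \<open>p > 1\<close> by simp
  moreover have "int k < p ^ k"
  proof -
    have "int k < 2 ^ k" by simp
    also have "\<dots> \<le> p ^ k" using \<open>p > 1\<close> by (intro power_mono) auto
    finally show ?thesis .
  qed
  ultimately show False by (simp add: k_def)
qed

text \<open>By descent the elements satisfy no nontrivial integer relation; clearing denominators
  makes them independent over the rationals, and independent sets are no larger than spanning
  ones.\<close>

lemma count_le_card_of_relations_divisible:
  fixes e :: "nat \<Rightarrow> 'a :: field_char_0" and p :: int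
  assumes p: "prime p"
    and div: "\<And>c i. (\<Sum>i<N. of_int (c i) * e i) = 0 \<Longrightarrow> i < N \<Longrightarrow> p dvd c i"
    and B: "finite B" "e ` {..<N} \<subseteq> rat_vs.span B"
  shows "N \<le> card B"
proof -
  have zero: "c i = 0" if "(\<Sum>i<N. of_int (c i) * e i) = 0" "i < N" for c i
    by (rule all_zero_of_relations_divisible[OF p _ that]) (rule div)
  have inj: "inj_on e {..<N}"
  proof (rule inj_onI, rule ccontr)
    fix i j assume ij: "i \<in> {..<N}" "j \<in> {..<N}" "e i = e j" "i \<noteq> j"
    \<comment> \<open>A repeated value would itself give a relation with coefficients 1 and
      -1.\<close>
    define c where "c k = (if k = i then 1 else if k = j then -1 else 0 :: int)" for k
    have "(\<Sum>k<N. of_int (c k) * e k) = (\<Sum>k<N. (if k = i then e i else 0) - (if k = j then e j else 0))"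
      using ij by (intro sum.cong) (auto simp: c_def)
    also have "\<dots> = 0" using ij by (simp add: sum_subtractf)
    finally show False using zero[of c i] ij by (simp add: c_def)
  qed
  have "rat_vs.independent (e ` {..<N})"
  proof (rule rat_vs.independent_if_scalars_zero)
    fix f x assume f: "(\<Sum>x\<in>e ` {..<N}. of_rat (f x) * x) = 0" and x: "x \<in> e ` {..<N}"
    obtain d k where d: "d > 0" "\<And>i. i \<in> {..<N} \<Longrightarrow> of_int d * f (e i) = of_int (k i)"
      using common_denominator[of "{..<N}" "\<lambda>i. f (e i)"] by blast
    have k: "of_int (k i) = (of_int d * of_rat (f (e i)) :: 'a)" if "i < N" for i
      using arg_cong[OF d(2), of i "of_rat :: rat \<Rightarrow> 'a"] that by (simp add: of_rat_mult)
    have "(\<Sum>i<N. of_int (k i) * e i) = (\<Sum>i<N. of_int d * (of_rat (f (e i)) * e i))"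
      by (intro sum.cong) (simp_all add: k mult.assoc)
    also have "\<dots> = of_int d * (\<Sum>x\<in>e ` {..<N}. of_rat (f x) * x)"
      by (simp add: sum.reindex[OF inj] sum_distrib_left)
    finally have "k i = 0" if "i < N" for i using zero f that by simp
    then show "f x = 0" using x d(1) d(2) by fastforce
  qed simp
  from rat_vs.independent_span_bound[OF B(1) this B(2)] show ?thesis
    by (simp add: card_image[OF inj])
qed

section \<open>Rational subspaces stable under multiplication by an element\<close>

lemma rat_span_of_int_mult_iff:
  assumes "c \<noteq> 0"
  shows "of_int c * x \<in> rat_vs.span B \<longleftrightarrow> x \<in> rat_vs.span B"
  using rat_vs.span_scale[of x B "of_int c"] rat_vs.span_scale[of "of_int c * x" B "1 / of_int c"] assms
  by (auto simp: of_rat_divide)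

lemma int_poly_eval_mult_in_span:
  assumes closed: "\<And>y. y \<in> rat_vs.span B \<Longrightarrow> w * y \<in> rat_vs.span B"
    and "y \<in> rat_vs.span B"
  shows "int_poly_eval f w * y \<in> rat_vs.span B"
proof (induction f)
  case (pCons a f)
  have "of_int a * y \<in> rat_vs.span B"
    using rat_vs.span_scale[OF assms(2), of "of_int a"] by simp
  then show ?case
    using rat_vs.span_add[OF _ closed[OF pCons.IH]] by (simp add: algebra_simps)
qed (simp add: rat_vs.span_zero)

text \<open>The polynomials carrying \<open>b\<close> into the stable span form a saturated ideal
  containing \<open>Q\<close>. As \<open>Q\<close> is irreducible, its generator \<open>G\<close>
  has the full degree of \<open>Q\<close> or is a unit, and a unit would put \<open>b\<close> itself
  into the span.\<close>

lemma degree_ge_of_int_poly_eval_mult_in_span: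
  fixes w b :: "'a :: field_char_0"
  assumes closed: "\<And>y. y \<in> rat_vs.span B \<Longrightarrow> w * y \<in> rat_vs.span B"
    and Q: "\<And>f. int_poly_eval f w = 0 \<longleftrightarrow> Q dvd f" "Q \<noteq> 0"
    and b: "b \<notin> rat_vs.span B"
    and f: "f \<noteq> 0" "int_poly_eval f w * b \<in> rat_vs.span B"
  shows "Polynomial.degree Q \<le> Polynomial.degree f"
proof -
  obtain G where G: "content G = 1"
    "{f. int_poly_eval f w * b \<in> rat_vs.span B} = {f. G dvd f}"
    using f
    by (rule_tac saturated_ideal_int_poly_principal[of "{f. int_poly_eval f w * b \<in> rat_vs.span B}" f])
      (auto simp: distrib_right mult.assoc rat_span_of_int_mult_iff
        intro: rat_vs.span_add int_poly_eval_mult_in_span[OF closed])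
  then have iff: "int_poly_eval f w * b \<in> rat_vs.span B \<longleftrightarrow> G dvd f" for f by blast
  have "int_poly_eval Q w = 0" using Q by simp
  then have "G dvd Q" by (simp add: rat_vs.span_zero flip: iff)
  then obtain g where g: "Q = G * g" by (elim dvdE)
  then have nz: "G \<noteq> 0" "g \<noteq> 0" using Q by auto
  have "int_poly_eval G w = 0 \<or> int_poly_eval g w = 0"
    using \<open>int_poly_eval Q w = 0\<close> by (simp add: g)
  then have "Polynomial.degree Q \<le> Polynomial.degree G"
  proof
    assume "int_poly_eval G w = 0"
    then show ?thesis using Q nz by (simp add: dvd_imp_degree_le)
  next
    assume "int_poly_eval g w = 0"
    then have "Polynomial.degree Q \<le> Polynomial.degree g"
      using Q nz by (simp add: dvd_imp_degree_le)
    then have "Polynomial.degree G = 0" using nz by (simp add: g degree_mult_eq)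
    then obtain a where "G = [:a:]" by (rule degree_eq_zeroE)
    then have "G dvd 1" using G by (simp add: is_unit_const_poly_iff)
    then have "b \<in> rat_vs.span B" by (simp flip: iff)
    with b show ?thesis by simp
  qed
  also have "\<dots> \<le> Polynomial.degree f"
    using f iff by (intro dvd_imp_degree_le) auto
  finally show ?thesis .
qed

text \<open>Clearing denominators turns the part of \<open>x\<close> along the powers into an
  integer polynomial. Its size is bounded through vanishing coefficients rather than the degree, so
  that \<open>i = 0\<close> correctly forces \<open>f = 0\<close>.\<close>

lemma span_powers_relation:
  fixes w b :: "'a :: field_char_0"
  assumes "x \<in> rat_vs.span (B \<union> (\<lambda>j. w ^ j * b) ` {..<i})"
  shows "\<exists>c f. c \<noteq> 0 \<and> (\<forall>k\<ge>i. Polynomial.coeff f k = 0) \<and>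
    of_int c * x - int_poly_eval f w * b \<in> rat_vs.span B"
  using assms
proof (induction x rule: rat_vs.span_induct_alt)
  case base
  show ?case by (intro exI[of _ 1] exI[of _ 0]) (simp add: rat_vs.span_zero)
next
  case (step r x y)
  obtain c f where cf: "c \<noteq> 0" "\<And>k. k \<ge> i \<Longrightarrow> Polynomial.coeff f k = 0"
    "of_int c * y - int_poly_eval f w * b \<in> rat_vs.span B"
    using step.IH by blast
  obtain s t where st: "quotient_of r = (s, t)" by (cases "quotient_of r")
  have t: "t > 0" and r: "of_rat r = (of_int s / of_int t :: 'a)"
    using quotient_of_denom_pos[OF st] quotient_of_div[OF st] by (simp_all add: of_rat_divide)
  from step.hyps show ?case
  proof
    assume "x \<in> B"
    have "of_int c * (of_rat r * x) = of_rat (of_int c * r) * x" by (simp add: of_rat_mult)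
    also have "\<dots> \<in> rat_vs.span B" using \<open>x \<in> B\<close> by (intro rat_vs.span_scale rat_vs.span_base)
    finally have "of_int c * (of_rat r * x) + (of_int c * y - int_poly_eval f w * b) \<in> rat_vs.span B"
      using cf(3) by (intro rat_vs.span_add)
    then show ?thesis using cf by (intro exI[of _ c] exI[of _ f]) (simp add: algebra_simps)
  next
    assume "x \<in> (\<lambda>j. w ^ j * b) ` {..<i}"
    then obtain j where j: "j < i" "x = w ^ j * b" by blast
    define f' where "f' = smult t f + Polynomial.monom (c * s) j"
    have "of_int (t * c) * (of_rat r * x + y) - int_poly_eval f' w * b =
        of_int t * (of_int c * y - int_poly_eval f w * b)"
      using t by (simp add: f'_def r j field_simps)
    also have "\<dots> \<in> rat_vs.span B"
      using cf(3) t by (simp add: rat_span_of_int_mult_iff)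
    finally show ?thesis
      using cf t j by (intro exI[of _ "t * c"] exI[of _ f']) (auto simp: f'_def)
  qed
qed

lemma independent_union_powers:
  fixes w b :: "'a :: field_char_0"
  assumes closed: "\<And>y. y \<in> rat_vs.span B \<Longrightarrow> w * y \<in> rat_vs.span B"
    and Q: "\<And>f. int_poly_eval f w = 0 \<longleftrightarrow> Q dvd f" "Q \<noteq> 0"
    and b: "b \<notin> rat_vs.span B"
    and B: "finite B" "rat_vs.independent B"
    and "i \<le> Polynomial.degree Q"
  shows "rat_vs.independent (B \<union> (\<lambda>j. w ^ j * b) ` {..<i}) \<and>
    card (B \<union> (\<lambda>j. w ^ j * b) ` {..<i}) = card B + i"
  using \<open>i \<le> Polynomial.degree Q\<close>
proof (induction i)
  case (Suc i)
  let ?S = "B \<union> (\<lambda>j. w ^ j * b) ` {..<i}"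
  have new: "w ^ i * b \<notin> rat_vs.span ?S"
  proof
    assume "w ^ i * b \<in> rat_vs.span ?S"
    then obtain c f where cf: "c \<noteq> 0" "\<And>k. k \<ge> i \<Longrightarrow> Polynomial.coeff f k = 0"
      "of_int c * (w ^ i * b) - int_poly_eval f w * b \<in> rat_vs.span B"
      using span_powers_relation by blast
    \<comment> \<open>A dependence of \<open>w^i * b\<close> on the earlier vectors yields a nonzero
      \<open>g\<close> of degree at most \<open>i < degree Q\<close> with \<open>g(w) * b\<close> in
      the span of \<open>B\<close>.\<close>
    define g where "g = Polynomial.monom c i + smult (- 1) f"
    have coeff_g: "Polynomial.coeff g i = c" "\<And>k. k > i \<Longrightarrow> Polynomial.coeff g k = 0"
      using cf by (simp_all add: g_def)
    have "int_poly_eval g w * b = of_int c * (w ^ i * b) - int_poly_eval f w * b"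
      unfolding g_def int_poly_eval_add int_poly_eval_smult by (simp add: algebra_simps)
    then have "int_poly_eval g w * b \<in> rat_vs.span B" using cf(3) by simp
    moreover have "g \<noteq> 0" using coeff_g cf by auto
    ultimately have "Polynomial.degree Q \<le> Polynomial.degree g"
      using degree_ge_of_int_poly_eval_mult_in_span[OF closed Q b] by blast
    moreover have "Polynomial.degree g \<le> i" by (rule degree_le) (use coeff_g in blast)
    ultimately show False using Suc.prems by simp
  qed
  have S: "B \<union> (\<lambda>j. w ^ j * b) ` {..<Suc i} = insert (w ^ i * b) ?S"
    by (auto simp: lessThan_Suc)
  have notin: "w ^ i * b \<notin> ?S"
    using new rat_vs.span_base[of "w ^ i * b" ?S] by metis
  have IH: "rat_vs.independent ?S" "card ?S = card B + i" using Suc.IH Suc.prems by simp_all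
  have "finite ?S" using B by simp
  then show ?case
    unfolding S using rat_vs.independent_insertI[OF new IH(1)] notin IH(2)
    by (simp only: card_insert_disjoint add_Suc_right simp_thms)
qed (use B in simp)

lemma span_union_powers_closed:
  fixes w b :: "'a :: field_char_0"
  assumes closed: "\<And>y. y \<in> rat_vs.span B \<Longrightarrow> w * y \<in> rat_vs.span B"
    and Q: "int_poly_eval Q w = 0" "Q \<noteq> 0"
    and y: "y \<in> rat_vs.span (B \<union> (\<lambda>j. w ^ j * b) ` {..<Polynomial.degree Q})"
  shows "w * y \<in> rat_vs.span (B \<union> (\<lambda>j. w ^ j * b) ` {..<Polynomial.degree Q})"
  using y
proof (induction y rule: rat_vs.span_induct_alt)
  case base
  show ?case by (simp add: rat_vs.span_zero)
next
  case (step r x y)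
  define m where "m = Polynomial.degree Q"
  let ?S = "B \<union> (\<lambda>j. w ^ j * b) ` {..<m}"
  have pow: "w ^ j * b \<in> rat_vs.span ?S" if "j < m" for j
    using that by (intro rat_vs.span_base) auto
  \<comment> \<open>Only the highest power can leave the spanning set under multiplication by
    \<open>w\<close>; the equation \<open>Q(w) = 0\<close> expresses it through lower ones.\<close>
  have top: "w ^ m * b \<in> rat_vs.span ?S"
  proof -
    define l where "l = Polynomial.lead_coeff Q"
    have "l \<noteq> 0" using Q by (simp add: l_def)
    have "(\<Sum>i<m. of_int (Polynomial.coeff Q i) * w ^ i) + of_int l * w ^ m = 0"
      using Q by (simp add: int_poly_eval_altdef m_def l_def flip: lessThan_Suc_atMost)
    then have "((\<Sum>i<m. of_int (Polynomial.coeff Q i) * w ^ i) + of_int l * w ^ m) * b = 0"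
      by simp
    then have "of_int l * (w ^ m * b) = - (\<Sum>i<m. of_rat (of_int (Polynomial.coeff Q i)) * (w ^ i * b))"
      by (simp add: algebra_simps sum_distrib_right sum_distrib_left eq_neg_iff_add_eq_0)
    also have "\<dots> \<in> rat_vs.span ?S"
      using pow by (intro rat_vs.span_neg rat_vs.span_sum rat_vs.span_scale) auto
    finally show ?thesis using rat_span_of_int_mult_iff[OF \<open>l \<noteq> 0\<close>] by blast
  qed
  have "w * x \<in> rat_vs.span ?S"
    using step.hyps unfolding m_def[symmetric]
  proof
    assume "x \<in> B"
    then have "w * x \<in> rat_vs.span B" by (intro closed rat_vs.span_base)
    then show ?thesis using rat_vs.span_mono[of B ?S] by blast
  next
    assume "x \<in> (\<lambda>j. w ^ j * b) ` {..<m}"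
    then obtain j where j: "j < m" "x = w ^ j * b" by blast
    then have "w * x = w ^ Suc j * b" by simp
    moreover have "Suc j < m \<or> Suc j = m" using j by auto
    ultimately show ?thesis using pow top by metis
  qed
  then have "of_rat r * (w * x) + w * y \<in> rat_vs.span ?S"
    using step.IH unfolding m_def[symmetric] by (intro rat_vs.span_add rat_vs.span_scale)
  then show ?case by (simp add: algebra_simps m_def)
qed

text \<open>\<open>V\<close> is a vector space over the field generated by \<open>w\<close>, which
  has degree \<open>m\<close>. In place of a tower argument, a basis of \<open>V\<close> is built
  from blocks \<open>b, w * b, ..., w^(m-1) * b\<close>.\<close>

lemma degree_dvd_dim:
  fixes V :: "'a :: field_char_0 set"
  assumes V: "rat_vs.subspace V" "finite C" "V \<subseteq> rat_vs.span C"
    and closed: "\<And>y. y \<in> V \<Longrightarrow> w * y \<in> V"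
    and Q: "\<And>f. int_poly_eval f w = 0 \<longleftrightarrow> Q dvd f" "Q \<noteq> 0"
  shows "Polynomial.degree Q dvd rat_vs.dim V"
proof -
  define m where "m = Polynomial.degree Q"
  have "m > 0"
  proof (rule ccontr)
    assume "\<not> m > 0"
    then obtain a where "Q = [:a:]" unfolding m_def by (auto elim: degree_eq_zeroE)
    then show False using Q(1)[of Q] Q(2) by simp
  qed
  define good where "good B \<longleftrightarrow> finite B \<and> B \<subseteq> V \<and> rat_vs.independent B \<and> m dvd card B \<and>
    (\<forall>y\<in>rat_vs.span B. w * y \<in> rat_vs.span B)" for B
  have "good {}" by (simp add: good_def rat_vs.independent_empty)
  moreover have "card B < Suc (card C)" if "good B" for B
    using rat_vs.independent_span_bound[OF \<open>finite C\<close>, of B] that V(3)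
    by (auto simp: good_def le_imp_less_Suc)
  \<comment> \<open>Independent subsets of \<open>V\<close> have at most \<open>card C\<close>
    elements, so a largest \<open>good\<close> set exists; adjoining a block to a non-spanning one
    would enlarge it by \<open>m > 0\<close>.\<close>
  ultimately obtain B where B: "good B" and max: "\<And>B'. good B' \<Longrightarrow> card B' \<le> card B"
    using ex_has_greatest_nat[of good "{}" card "Suc (card C)"] by blast
  have "V \<subseteq> rat_vs.span B"
  proof
    fix b assume "b \<in> V"
    show "b \<in> rat_vs.span B"
    proof (rule ccontr)
      assume b: "b \<notin> rat_vs.span B"
      define B' where "B' = B \<union> (\<lambda>j. w ^ j * b) ` {..<m}"
      have clB: "w * y \<in> rat_vs.span B" if "y \<in> rat_vs.span B" for y
        using B that by (simp add: good_def)
      have ind: "rat_vs.independent B'" "card B' = card B + m"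
        using independent_union_powers[OF clB Q b, of m] B by (simp_all add: good_def B'_def m_def)
      have "w ^ j * b \<in> V" for j
        by (induction j) (use \<open>b \<in> V\<close> closed in \<open>simp_all add: mult.assoc\<close>)
      moreover have "w * y \<in> rat_vs.span B'" if "y \<in> rat_vs.span B'" for y
        using span_union_powers_closed[OF clB, of Q y b] Q that by (simp add: B'_def m_def)
      ultimately have "good B'"
        using B ind by (auto simp: good_def B'_def)
      then show False using max ind \<open>m > 0\<close> by fastforce
    qed
  qed
  then have "card B = rat_vs.dim V"
    using B by (intro rat_vs.basis_card_eq_dim) (auto simp: good_def)
  then show ?thesis using B by (simp add: good_def m_def)
qed

subsection \<open>Totally ramified primes\<close>

lemma number_field_closed:
  assumes "number_field F"
  shows "1 \<in> F" "x \<in> F \<Longrightarrow> y \<in> F \<Longrightarrow> x + y \<in> F" "x \<in> F \<Longrightarrow> y \<in> F \<Longrightarrow> x * y \<in> F"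
    "of_int a \<in> F" "of_rat r \<in> F"
proof -
  have sf: "subfield F ring_of_type_algebra" using assms by (simp add: number_field_def)
  interpret R: field "ring_of_type_algebra :: 'a ring" by (rule field_from_type_algebra)
  note sr = subringE[OF subcring.axioms(1)[OF subdomain.axioms(1)[OF subfield.axioms(1)[OF sf]]]]
  show one: "1 \<in> F" and add: "x \<in> F \<Longrightarrow> y \<in> F \<Longrightarrow> x + y \<in> F"
    and mult: "x \<in> F \<Longrightarrow> y \<in> F \<Longrightarrow> x * y \<in> F" for x y
    using sr by (simp_all add: ring_of_type_algebra_def)
  have minus: "- x \<in> F" if "x \<in> F" for x
  proof -
    have "\<ominus>\<^bsub>ring_of_type_algebra\<^esub> x = - x"
      by (rule R.minus_equality) (simp_all add: ring_of_type_algebra_def)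
    then show ?thesis using sr(5)[OF that] by simp
  qed
  have nat: "of_nat k \<in> F" for k
    using sr(2) one add by (induction k) (simp_all add: ring_of_type_algebra_def)
  show int: "of_int a \<in> F" for a
    using nat minus by (cases a) (auto simp del: of_nat_Suc)
  have inverse: "inverse x \<in> F" if "x \<in> F" for x
  proof (cases "x = 0")
    case False
    have "x \<in> F - {\<zero>\<^bsub>ring_of_type_algebra\<^esub>}"
      using that False by (simp add: ring_of_type_algebra_def)
    then have "inv\<^bsub>ring_of_type_algebra\<^esub> x \<in> F"
      using R.subfield_m_inv(1)[OF sf] by blast
    moreover have "inv\<^bsub>ring_of_type_algebra\<^esub> x = inverse x"
      using False by (intro R.comm_inv_char) (simp_all add: ring_of_type_algebra_def)
    ultimately show ?thesis by simp
  qed (use that in simp)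
  show "of_rat r \<in> F"
  proof (cases r)
    case (Fract a b)
    then show ?thesis using int mult inverse by (simp add: of_rat_rat divide_inverse)
  qed
qed

lemma number_field_subspace: "number_field F \<Longrightarrow> rat_vs.subspace F"
  using number_field_closed[of F] number_field_closed(4)[of F 0]
  by (auto simp: rat_vs.subspace_def)

lemma ring_of_integers_simps [simp]:
  "carrier (ring_of_integers F) = {x \<in> F. algebraic_int x}"
  "x \<otimes>\<^bsub>ring_of_integers F\<^esub> y = x * y" "x \<oplus>\<^bsub>ring_of_integers F\<^esub> y = x + y"
  "\<one>\<^bsub>ring_of_integers F\<^esub> = 1" "\<zero>\<^bsub>ring_of_integers F\<^esub> = 0"
  by (simp_all add: ring_of_integers_def ring_of_type_algebra_def)

lemma ideal_ring_of_integersD: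
  assumes "number_field F" "ideal J (ring_of_integers F)"
  shows "x \<in> J \<Longrightarrow> x \<in> F" "x \<in> J \<Longrightarrow> algebraic_int x" "0 \<in> J"
    "x \<in> J \<Longrightarrow> y \<in> J \<Longrightarrow> x + y \<in> J" "x \<in> J \<Longrightarrow> y \<in> J \<Longrightarrow> x - y \<in> J"
    "y \<in> F \<Longrightarrow> algebraic_int y \<Longrightarrow> x \<in> J \<Longrightarrow> y * x \<in> J"
    "x \<in> J \<Longrightarrow> of_int a * x \<in> J"
proof -
  interpret ideal J "ring_of_integers F" by fact
  show "x \<in> J \<Longrightarrow> x \<in> F" "x \<in> J \<Longrightarrow> algebraic_int x" "0 \<in> J"
    using a_subset additive_subgroup.zero_closed[OF is_additive_subgroup] by auto
  show add: "x \<in> J \<Longrightarrow> y \<in> J \<Longrightarrow> x + y \<in> J" for x y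
    using additive_subgroup.a_closed[OF is_additive_subgroup] by simp
  show mult: "y \<in> F \<Longrightarrow> algebraic_int y \<Longrightarrow> x \<in> J \<Longrightarrow> y * x \<in> J" for x y
    using I_l_closed by simp
  show int: "x \<in> J \<Longrightarrow> of_int a * x \<in> J" for x a
    using mult number_field_closed(4)[OF assms(1)] by simp
  show "x \<in> J \<Longrightarrow> y \<in> J \<Longrightarrow> x - y \<in> J"
    using add[of x "-y"] int[of y "-1"] by simp
qed

lemma ideal_ring_of_integers_sum:
  assumes "number_field F" "ideal J (ring_of_integers F)" "\<And>i. i \<in> A \<Longrightarrow> f i \<in> J"
  shows "sum f A \<in> J"
  using assms(3) by (induction A rule: infinite_finite_induct)
    (auto intro: ideal_ring_of_integersD(3,4)[OF assms(1,2)])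

section \<open>The filtration by powers of the totally ramified prime ideal\<close>

locale totally_ramified_prime =
  fixes F P :: "'a :: field_char_0 set" and p n :: nat
  assumes number_field: "number_field F"
    and P: "primeideal P (ring_of_integers F)"
    and p: "prime p"
    and n: "n = field_degree F" "n > 0"
    and ramified: "PIdl\<^bsub>ring_of_integers F\<^esub> (of_nat p) = P [^]\<^bsub>ideals_set (ring_of_integers F)\<^esub> n"
begin

sublocale primeideal P "ring_of_integers F" by (rule P)

definition "power_P i = P [^]\<^bsub>ideals_set (ring_of_integers F)\<^esub> (i :: nat)"

lemma power_P_0: "power_P 0 = carrier (ring_of_integers F)"
  by (simp add: power_P_def nat_pow_def ideals_set_def)

lemma power_P_Suc: "power_P (Suc i) = ideal_prod (ring_of_integers F) (power_P i) P"
  by (simp add: power_P_def nat_pow_def ideals_set_def)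

lemma power_P_ideal: "ideal (power_P i) (ring_of_integers F)"
proof (induction i)
  case 0
  show ?case unfolding power_P_0 by (rule oneideal)
next
  case (Suc i)
  then show ?case unfolding power_P_Suc by (intro ideal_prod_is_ideal is_ideal)
qed

lemmas power_PD = ideal_ring_of_integersD[OF number_field power_P_ideal]

lemmas PD = ideal_ring_of_integersD[OF number_field is_ideal]

lemma power_P_antimono: "i \<le> j \<Longrightarrow> power_P j \<subseteq> power_P i"
proof (rule lift_Suc_antimono_le[of power_P])
  show "power_P (Suc i) \<subseteq> power_P i" for i
    unfolding power_P_Suc using ideal_prod_inter[OF power_P_ideal is_ideal] by blast
qed

lemma power_P_1: "power_P 1 \<subseteq> P"
  using ideal_prod_inter[OF power_P_ideal is_ideal, of 0] by (simp add: power_P_Suc)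

lemma power_P_n: "power_P n = {x * of_nat p | x. x \<in> F \<and> algebraic_int x}"
  unfolding power_P_def ramified[symmetric] by (simp add: cgenideal_def)

lemma one_notin_P: "1 \<notin> P"
proof
  assume "1 \<in> P"
  then have "P = carrier (ring_of_integers F)" using one_imp_carrier by simp
  then show False using I_notcarr by simp
qed

lemma p_mult_in_power_P:
  assumes "x \<in> F" "algebraic_int x" "i \<le> n" "int p dvd c"
  shows "of_int c * x \<in> power_P i"
proof -
  obtain k where k: "c = int p * k" using assms(4) by (elim dvdE)
  have "x * of_nat p \<in> power_P n" unfolding power_P_n using assms by blast
  then have "of_int k * (x * of_nat p) \<in> power_P n" by (rule power_PD(7))
  then show ?thesis using power_P_antimono[OF \<open>i \<le> n\<close>] by (auto simp: k mult_ac)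
qed

text \<open>The quotient by \<open>P^i\<close> is annihilated by \<open>p\<close>, since
  \<open>P^n\<close> is generated by \<open>p\<close> and \<open>i <= n\<close>; hence an integer
  prime to \<open>p\<close> acts invertibly on it, by Bezout.\<close>

lemma int_mult_in_power_P_cancel:
  assumes x: "x \<in> F" "algebraic_int x" and "i \<le> n" "of_int c * x \<in> power_P i" "\<not> int p dvd c"
  shows "x \<in> power_P i"
proof -
  have "coprime (int p) c" using p assms(5) by (simp add: prime_imp_coprime)
  then obtain s t where "s * int p + t * c = 1"
    using bezout_int[of "int p" c] by (auto simp: coprime_iff_gcd_eq_1)
  then have "x = of_int (s * int p + t * c) * x" by simp
  also have "\<dots> = of_int (s * int p) * x + of_int t * (of_int c * x)"
    by (simp add: algebra_simps)
  also have "\<dots> \<in> power_P i"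
    using p_mult_in_power_P[OF x \<open>i \<le> n\<close>, of "s * int p"] power_PD(4,7) assms(4) by simp
  finally show ?thesis .
qed

lemma int_in_P_iff: "of_int c \<in> P \<longleftrightarrow> int p dvd c"
proof
  assume c: "of_int c \<in> P"
  show "int p dvd c"
  proof (rule ccontr)
    assume "\<not> int p dvd c"
    then have "coprime (int p) c" using p by (simp add: prime_imp_coprime)
    then obtain s t where st: "s * int p + t * c = 1"
      using bezout_int[of "int p" c] by (auto simp: coprime_iff_gcd_eq_1)
    have "of_int (s * int p) * 1 \<in> power_P 1"
      using n number_field_closed(1)[OF number_field] by (intro p_mult_in_power_P) auto
    then have "of_int (s * int p) \<in> P" using power_P_1 by auto
    then have "of_int (s * int p) + of_int t * of_int c \<in> P" using PD(4,7) c by blast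
    then have "of_int (s * int p + t * c) \<in> P" by simp
    then show False using one_notin_P unfolding st by simp
  qed
next
  assume "int p dvd c"
  then have "of_int c * 1 \<in> power_P 1"
    using n number_field_closed(1)[OF number_field] by (intro p_mult_in_power_P) auto
  then show "of_int c \<in> P" using power_P_1 by auto
qed

text \<open>Equality at one step makes the chain stationary from there on, so
  \<open>P^(n+1) = P^n\<close>. Then \<open>p\<close> would be \<open>p\<close> times an element of
  \<open>P\<close>, and cancelling gives 1 in \<open>P\<close>.\<close>

lemma power_P_strict:
  assumes "i < n"
  shows "power_P (Suc i) \<noteq> power_P i"
proof
  assume eq: "power_P (Suc i) = power_P i"
  have "power_P (Suc (i + k)) = power_P (i + k)" for k
  proof (induction k)
    case (Suc k)
    then show ?case by (metis add_Suc_right power_P_Suc)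
  qed (simp add: eq)
  from this[of "n - i"] have "power_P (Suc n) = power_P n" using assms by simp
  moreover have "of_nat p \<in> power_P n"
    unfolding power_P_n using number_field_closed(1)[OF number_field] by force
  ultimately have "of_nat p \<in> ideal_prod (ring_of_integers F) (power_P n) P"
    by (simp add: power_P_Suc)
  moreover have "\<exists>y\<in>P. x = of_nat p * y" if "x \<in> ideal_prod (ring_of_integers F) (power_P n) P" for x
    using that
  proof induction
    case (prod s t)
    then obtain y where "s = y * of_nat p" "y \<in> F" "algebraic_int y" unfolding power_P_n by blast
    then show ?case using PD(6)[of y t] prod by (intro bexI[of _ "y * t"]) (auto simp: mult_ac)
  next
    case (sum s t)
    then obtain y z where "y \<in> P" "z \<in> P" "s = of_nat p * y" "t = of_nat p * z" by blast
    then show ?case using PD(4)[of y z] by (intro bexI[of _ "y + z"]) (auto simp: algebra_simps)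
  qed
  ultimately obtain y where "y \<in> P" "of_nat p = of_nat p * y" by blast
  then show False using one_notin_P p by simp
qed

text \<open>
  Elements \<open>e i \<in> P\<^sup>i - P\<^sup>i\<^sup>+\<^sup>1\<close> for \<open>i < n\<close>, together with an element not congruent to an integer
  modulo \<open>P\<close>, would satisfy only integer relations divisible by \<open>p\<close>; there are too many of them.
\<close>
lemma residue_is_int:
  assumes x: "x \<in> F" "algebraic_int x"
  obtains a where "x - of_int a \<in> P"
proof (rule ccontr)
  assume "\<not> thesis"
  then have no: "x - of_int a \<notin> P" for a using that by blast
  have "\<exists>y. y \<in> power_P i - power_P (Suc i)" if "i < n" for i
    using power_P_strict[OF that] power_P_antimono[of i "Suc i"] by auto
  then obtain g where g: "\<And>i. i < n \<Longrightarrow> g i \<in> power_P i - power_P (Suc i)" by metis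
  \<comment> \<open>There are \<open>n + 1\<close> elements: slot \<open>n\<close> holds
    \<open>x\<close>, and slot 0 holds 1, so that its term in a relation is a rational
    integer.\<close>
  define e where "e i = (if i = n then x else if i = 0 then 1 else g i)" for i
  have e_n: "e n = x" by (simp add: e_def)
  have e_0: "e 0 = 1" using n by (simp add: e_def)
  have e: "e i \<in> power_P i" "e i \<notin> power_P (Suc i)" if "i < n" for i
    using g[OF that] that power_P_1 one_notin_P number_field_closed(1)[OF number_field]
    by (auto simp: e_def power_P_0)
  have eF: "e i \<in> F" "algebraic_int (e i)" if "i \<le> n" for i
    using that e(1)[of i] power_PD(1,2)[of "e i" i] x by (cases "i = n"; auto simp: e_n)+
  have div: "int p dvd c i" if rel: "(\<Sum>i<Suc n. of_int (c i) * e i) = 0" and i: "i < Suc n" for c i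
  proof -
    \<comment> \<open>Modulo \<open>P\<close> a relation reads \<open>c 0 + c n * x = 0\<close>; if
      \<open>c n\<close> were invertible modulo \<open>p\<close>, then \<open>x\<close> would be
      congruent to an integer.\<close>
    have cn: "int p dvd c n"
    proof (rule ccontr)
      assume "\<not> int p dvd c n"
      then have "coprime (int p) (c n)" using p by (simp add: prime_imp_coprime)
      then obtain s t where st: "s * int p + t * c n = 1"
        using bezout_int[of "int p" "c n"] by (auto simp: coprime_iff_gcd_eq_1)
      define r where "r = (\<Sum>i\<in>{0<..<n}. of_int (c i) * e i)"
      have "r \<in> P" unfolding r_def
      proof (rule ideal_ring_of_integers_sum[OF number_field is_ideal])
        fix i assume "i \<in> {0<..<n}"
        then have "e i \<in> P" using e(1)[of i] power_P_antimono[of 1 i] power_P_1 by auto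
        then show "of_int (c i) * e i \<in> P" by (rule PD(7))
      qed
      moreover have "{..<n} = insert 0 {0<..<n}" using n by auto
      then have "of_int (c 0) + r + of_int (c n) * x = 0"
        using rel by (simp add: r_def e_0 e_n)
      then have r: "r = - of_int (c 0) - of_int (c n) * x"
        using add_diff_cancel[of r "of_int (c 0) + of_int (c n) * x"] by (simp add: add_ac)
      moreover have "of_int (s * int p) * x \<in> P"
        using p_mult_in_power_P[OF x, of 1 "s * int p"] n power_P_1 by auto
      ultimately have "of_int (s * int p) * x - of_int t * r \<in> P" using PD(5,7) by blast
      also have "of_int (s * int p) * x - of_int t * r =
          of_int (s * int p + t * c n) * x - of_int (- t * c 0)"
        by (simp add: r algebra_simps)
      finally show False using no[of "- t * c 0"] st by simp
    qed
    \<comment> \<open>Terms before \<open>i\<close> and the term of \<open>x\<close> have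
      coefficients divisible by \<open>p\<close>, while terms strictly between \<open>i\<close> and
      \<open>n\<close> lie in \<open>P^(i+1)\<close> already. So \<open>c i * e i\<close> lies in
      \<open>P^(i+1)\<close> although \<open>e i\<close> does not.\<close>
    have ci: "int p dvd c i" if "i < n" for i
      using that
    proof (induction i rule: less_induct)
      case (less i)
      define r where "r = (\<Sum>j\<in>{..<Suc n} - {i}. of_int (c j) * e j)"
      have "r \<in> power_P (Suc i)" unfolding r_def
      proof (rule ideal_ring_of_integers_sum[OF number_field power_P_ideal])
        fix j assume j: "j \<in> {..<Suc n} - {i}"
        show "of_int (c j) * e j \<in> power_P (Suc i)"
        proof (cases "j < i \<or> j = n")
          case True
          then show ?thesis using less cn j by (intro p_mult_in_power_P eF) auto
        next
          case False
          then have "e j \<in> power_P (Suc i)"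
            using e(1)[of j] power_P_antimono[of "Suc i" j] j by auto
          then show ?thesis by (rule power_PD(7))
        qed
      qed
      moreover have "of_int (c i) * e i + r = 0"
        using sum.remove[of "{..<Suc n}" i "\<lambda>j. of_int (c j) * e j"] rel less.prems
        by (simp only: r_def finite_lessThan lessThan_iff less_SucI)
      then have "of_int (c i) * e i = 0 - r" using add_diff_cancel[of "of_int (c i) * e i" r] by simp
      ultimately have "of_int (c i) * e i \<in> power_P (Suc i)" using power_PD(3,5) by metis
      then show ?case
        using int_mult_in_power_P_cancel[OF eF, of i "Suc i"] e(2) less.prems by auto
    qed
    show ?thesis using cn ci i by (cases "i = n") auto
  qed
  obtain C where C: "finite C" "F \<subseteq> rat_vs.span C"
    using number_field by (auto simp: number_field_def)
  obtain B where B: "B \<subseteq> F" "rat_vs.independent B" "F \<subseteq> rat_vs.span B" "card B = rat_vs.dim F"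
    by (rule rat_vs.basis_exists)
  have "finite B" using rat_vs.independent_span_bound[OF C(1) B(2)] B(1) C(2) by auto
  \<comment> \<open>This contradicts that a basis of \<open>F\<close> has \<open>n\<close>
    elements.\<close>
  then have "Suc n \<le> card B"
    using p div eF B(3) by (intro count_le_card_of_relations_divisible[where p = "int p" and N = "Suc n" and e = e]) auto
  then show False using B(4) n by (simp add: field_degree_def)
qed

lemma power_in_power_P: "x \<in> P \<Longrightarrow> x ^ i \<in> power_P i"
proof (induction i)
  case 0
  show ?case using number_field_closed(1)[OF number_field] by (simp add: power_P_0)
next
  case (Suc i)
  then have "x ^ i \<otimes>\<^bsub>ring_of_integers F\<^esub> x \<in> power_P (Suc i)"
    unfolding power_P_Suc by (intro ideal_prod.prod)
  then show ?case by (simp add: mult.commute)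
qed

lemma unit_residue:
  assumes "u \<in> Units (ring_of_integers F)"
  obtains a m where "u - of_int a \<in> P" "m dvd n" "int p dvd a ^ m - 1 \<or> int p dvd a ^ m + 1"
proof -
  obtain v where u: "u \<in> F" "algebraic_int u" and v: "algebraic_int v" "u * v = 1"
    using assms by (auto simp: Units_def)
  obtain a where a: "u - of_int a \<in> P" using residue_is_int[OF u] .
  define w where "w = u - of_int a"
  have "w ^ n \<in> power_P n" using a by (simp add: power_in_power_P w_def)
  then obtain z where z: "algebraic_int z" "w ^ n = of_int (int p) * z"
    unfolding power_P_n by (auto simp: mult.commute)
  have wv: "(w + of_int a) * v = 1" using v by (simp add: w_def)
  obtain Q where Q: "\<And>f. int_poly_eval f w = 0 \<longleftrightarrow> Q dvd f" "\<bar>Polynomial.lead_coeff Q\<bar> = 1"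
    "int p dvd a ^ Polynomial.degree Q - 1 \<or> int p dvd a ^ Polynomial.degree Q + 1"
    using unit_residue_power_mod_prime[OF _ n(2) z v(1) wv] p by auto
  obtain C where C: "finite C" "F \<subseteq> rat_vs.span C"
    using number_field by (auto simp: number_field_def)
  have "w \<in> F" using PD(1) a by (simp add: w_def)
  \<comment> \<open>\<open>F\<close> itself is the stable subspace to which the divisibility of
    dimensions applies.\<close>
  then have "Polynomial.degree Q dvd n"
    unfolding n field_degree_def using Q(2) C number_field_closed(3)[OF number_field]
    by (intro degree_dvd_dim[OF number_field_subspace[OF number_field] C _ Q(1)]) auto
  with a Q(3) show ?thesis using that by blast
qed

end

section \<open>Residues modulo 5 and the unit equation\<close>

text \<open>The classes 2 and 3 square to -1 modulo 5, so their odd powers are again 2 or 3 and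
  never 1 or -1.\<close>

lemma odd_power_mod_5:
  fixes a :: int
  assumes "odd m" "5 dvd a ^ m - 1 \<or> 5 dvd a ^ m + 1"
  shows "5 dvd a - 1 \<or> 5 dvd a + 1"
proof -
  obtain k where m: "m = Suc (2 * k)" using \<open>odd m\<close> by (auto elim: oddE)
  have no: "\<not> (5 dvd b - 1 \<or> 5 dvd b + 1)"
    if "b mod 5 = 0 \<or> b mod 5 = 2 \<or> b mod 5 = 3" for b :: int
    using that by presburger
  have "5 dvd a \<or> (5 dvd a - 1 \<or> 5 dvd a + 1) \<or> (a mod 5 = 2 \<or> a mod 5 = 3)" by presburger
  then consider "5 dvd a" | "5 dvd a - 1 \<or> 5 dvd a + 1" | "a mod 5 = 2 \<or> a mod 5 = 3"
    by blast
  then show ?thesis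
  proof cases
    case 1
    then have "a ^ m mod 5 = 0" by (simp add: m)
    then show ?thesis using assms(2) no[of "a ^ m"] by simp
  next
    case 3
    have "a ^ 2 mod 5 = (a mod 5) ^ 2 mod 5" by (simp add: power_mod)
    then have sq: "a ^ 2 mod 5 = (- 1) mod 5" using 3 by auto
    have "a ^ m mod 5 = (a * (a ^ 2 mod 5) ^ k) mod 5"
      unfolding m power_Suc power_mult by (metis mod_mult_right_eq power_mod)
    also have "\<dots> = (a * (- 1) ^ k) mod 5"
      unfolding sq by (metis mod_mult_right_eq power_mod)
    finally have "a ^ m mod 5 = a mod 5 \<or> a ^ m mod 5 = (- a) mod 5"
      by (cases "even k") auto
    moreover have "(- a) mod 5 = 2 \<or> (- a) mod 5 = 3" using 3 by presburger
    ultimately have "a ^ m mod 5 = 2 \<or> a ^ m mod 5 = 3" using 3 by auto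
    then show ?thesis using assms(2) no[of "a ^ m"] by simp
  qed
qed

theorem corollary2:
  fixes F :: "'a :: field_char_0 set"
  assumes "number_field F"
    and "totally_ramified 5 F"
    and "odd (class_number F)"
    and "odd (field_degree F)"
  shows "\<not> (\<exists>u\<in>Units (ring_of_integers F). \<exists>v\<in>Units (ring_of_integers F). u + v = 1)"
proof safe
  fix u v
  assume u: "u \<in> Units (ring_of_integers F)" and v: "v \<in> Units (ring_of_integers F)"
    and uv: "u + v = 1"
  obtain P where P: "primeideal P (ring_of_integers F)"
    "PIdl\<^bsub>ring_of_integers F\<^esub> (of_nat 5) = P [^]\<^bsub>ideals_set (ring_of_integers F)\<^esub> field_degree F"
    using assms(2) unfolding totally_ramified_def by blast
  interpret totally_ramified_prime F P 5 "field_degree F"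
    using assms P by (intro totally_ramified_prime.intro) (auto simp: totally_ramified_def odd_pos)
  have residue: "\<exists>a. x - of_int a \<in> P \<and> (5 dvd a - 1 \<or> 5 dvd a + 1)"
    if x: "x \<in> Units (ring_of_integers F)" for x
  proof -
    obtain a m where am: "x - of_int a \<in> P" "m dvd field_degree F"
      "int 5 dvd a ^ m - 1 \<or> int 5 dvd a ^ m + 1"
      using unit_residue[OF x] .
    \<comment> \<open>The parity of the degree enters here: its divisor \<open>m\<close> is odd as
      well.\<close>
    have "odd m" using am(2) assms(4) dvd_trans by blast
    with am show ?thesis using odd_power_mod_5[of m a] by auto
  qed
  obtain a where a: "u - of_int a \<in> P" "5 dvd a - 1 \<or> 5 dvd a + 1" using residue[OF u] by blast
  obtain b where b: "v - of_int b \<in> P" "5 dvd b - 1 \<or> 5 dvd b + 1" using residue[OF v] by blast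
  have "(u - of_int a) + (v - of_int b) = of_int (1 - a - b)"
    using uv by (simp add: algebra_simps)
  \<comment> \<open>With \<open>a\<close> and \<open>b\<close> each 1 or -1 modulo 5, the integer
    \<open>1 - a - b\<close> is 1, -1 or 3 modulo 5, never 0.\<close>
  then have "int 5 dvd 1 - a - b" using PD(4)[OF a(1) b(1)] int_in_P_iff by metis
  then show False using a(2) b(2) by presburger
qed

end
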